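(* There is a finitely generated structure $\mathcal{A}$ such that $\mathrm{Th}_2(\mathcal{A})$ is not quasi-categorical.
   Context: Formulas are in $\mathcal{L}_{\omega_1\omega}$; $\Sigma^0_2$ sentences are countable disjunctions of $\exists\bar x\,\phi$ with $\phi$ a countable conjunction of $\forall\bar y\,\theta$ ($\theta$ finitary quantifier-free), and $\Pi^0_2$ sentences are countable conjunctions of $\forall\bar x\,\phi$ with $\phi$ a countable disjunction of $\exists\bar y\,\theta$. The 2-theory $\mathrm{Th}_2(\mathcal{A})$ is the set of $\Sigma^0_2$ and $\Pi^0_2$ sentences true in $\mathcal{A}$. For finitely generated $\mathcal{A}$, $\mathrm{Th}_2(\mathcal{A})$ is quasi-categorical if $\mathcal{A}$ is, up to isomorphism, the only finitely generated model of $\mathrm{Th}_2(\mathcal{A})$. *)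

theory Defs
  imports Main "HOL-Library.Countable_Set_Type"
begin

text \<open>A language assigns an arity to each of its symbols; function symbols of arity 0 are
  constants. Symbols mapped to \<^term>\<open>None\<close> do not belong to the language.\<close>

record ('f, 'r) lang =
  fun_arity :: "'f \<Rightarrow> nat option"
  rel_arity :: "'r \<Rightarrow> nat option"

record ('f, 'r, 'a) struct =
  univ :: "'a set"
  fun_int :: "'f \<Rightarrow> 'a list \<Rightarrow> 'a"
  rel_int :: "'r \<Rightarrow> 'a list \<Rightarrow> bool"

definition is_struct :: "('f, 'r) lang \<Rightarrow> ('f, 'r, 'a) struct \<Rightarrow> bool" where
  "is_struct L A \<longleftrightarrow> univ A \<noteq> {} \<and>
     (\<forall>f as. fun_arity L f = Some (length as) \<and> set as \<subseteq> univ A \<longrightarrow> fun_int A f as \<in> univ A)"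

definition isomorphic ::
    "('f, 'r) lang \<Rightarrow> ('f, 'r, 'a) struct \<Rightarrow> ('f, 'r, 'b) struct \<Rightarrow> bool" where
  "isomorphic L A B \<longleftrightarrow> (\<exists>h. bij_betw h (univ A) (univ B) \<and>
     (\<forall>f as. fun_arity L f = Some (length as) \<and> set as \<subseteq> univ A \<longrightarrow>
        h (fun_int A f as) = fun_int B f (map h as)) \<and>
     (\<forall>r as. rel_arity L r = Some (length as) \<and> set as \<subseteq> univ A \<longrightarrow>
        (rel_int A r as \<longleftrightarrow> rel_int B r (map h as))))"

inductive_set generated :: "('f, 'r) lang \<Rightarrow> ('f, 'r, 'a) struct \<Rightarrow> 'a set \<Rightarrow> 'a set"
  for L A S where
  base: "s \<in> S \<Longrightarrow> s \<in> generated L A S"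
| app: "fun_arity L f = Some (length as) \<Longrightarrow> (\<And>a. a \<in> set as \<Longrightarrow> a \<in> generated L A S)
    \<Longrightarrow> fun_int A f as \<in> generated L A S"

definition finitely_generated :: "('f, 'r) lang \<Rightarrow> ('f, 'r, 'a) struct \<Rightarrow> bool" where
  "finitely_generated L A \<longleftrightarrow> (\<exists>S \<subseteq> univ A. finite S \<and> generated L A S = univ A)"

datatype 'f trm = Var nat | App 'f "'f trm list"

text \<open>The formulas of \<open>L\<^sub>\<omega>\<^sub>1\<^sub>\<omega>\<close>: the type \<^typ>\<open>'a cset\<close> of countable (possibly finite or empty)
  sets makes the conjunctions \<open>CConj\<close> and disjunctions \<open>CDisj\<close> countable.\<close>

datatype ('f, 'r) fm =
    Eql "'f trm" "'f trm"
  | Rel 'r "'f trm list"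
  | Neg "('f, 'r) fm"
  | CConj "('f, 'r) fm cset"
  | CDisj "('f, 'r) fm cset"
  | FEx nat "('f, 'r) fm"
  | FAll nat "('f, 'r) fm"

inductive wf_trm :: "('f, 'r) lang \<Rightarrow> 'f trm \<Rightarrow> bool" for L where
  "wf_trm L (Var x)"
| "fun_arity L f = Some (length ts) \<Longrightarrow> (\<And>t. t \<in> set ts \<Longrightarrow> wf_trm L t) \<Longrightarrow> wf_trm L (App f ts)"

inductive wf_fm :: "('f, 'r) lang \<Rightarrow> ('f, 'r) fm \<Rightarrow> bool" for L where
  "wf_trm L s \<Longrightarrow> wf_trm L t \<Longrightarrow> wf_fm L (Eql s t)"
| "rel_arity L r = Some (length ts) \<Longrightarrow> (\<And>t. t \<in> set ts \<Longrightarrow> wf_trm L t) \<Longrightarrow> wf_fm L (Rel r ts)"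
| "wf_fm L \<phi> \<Longrightarrow> wf_fm L (Neg \<phi>)"
| "(\<And>\<phi>. \<phi> \<in> rcset \<Phi> \<Longrightarrow> wf_fm L \<phi>) \<Longrightarrow> wf_fm L (CConj \<Phi>)"
| "(\<And>\<phi>. \<phi> \<in> rcset \<Phi> \<Longrightarrow> wf_fm L \<phi>) \<Longrightarrow> wf_fm L (CDisj \<Phi>)"
| "wf_fm L \<phi> \<Longrightarrow> wf_fm L (FEx x \<phi>)"
| "wf_fm L \<phi> \<Longrightarrow> wf_fm L (FAll x \<phi>)"

primrec fv_trm :: "'f trm \<Rightarrow> nat set" where
  "fv_trm (Var x) = {x}"
| "fv_trm (App f ts) = \<Union> (set (map fv_trm ts))"

primrec fv :: "('f, 'r) fm \<Rightarrow> nat set" where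
  "fv (Eql s t) = fv_trm s \<union> fv_trm t"
| "fv (Rel r ts) = \<Union> (set (map fv_trm ts))"
| "fv (Neg \<phi>) = fv \<phi>"
| "fv (CConj \<Phi>) = \<Union> (rcset (cimage fv \<Phi>))"
| "fv (CDisj \<Phi>) = \<Union> (rcset (cimage fv \<Phi>))"
| "fv (FEx x \<phi>) = fv \<phi> - {x}"
| "fv (FAll x \<phi>) = fv \<phi> - {x}"

primrec eval_trm :: "('f, 'r, 'a) struct \<Rightarrow> (nat \<Rightarrow> 'a) \<Rightarrow> 'f trm \<Rightarrow> 'a" where
  "eval_trm A e (Var x) = e x"
| "eval_trm A e (App f ts) = fun_int A f (map (eval_trm A e) ts)"

text \<open>In the clauses for \<open>CConj\<close> and \<open>CDisj\<close>, \<open>s\<close> ranges over the truth functions of the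
  members of \<open>\<Phi>\<close>; see \<open>sat_CConj\<close> and \<open>sat_CDisj\<close> for the usual form.\<close>

primrec sat :: "('f, 'r, 'a) struct \<Rightarrow> ('f, 'r) fm \<Rightarrow> (nat \<Rightarrow> 'a) \<Rightarrow> bool" where
  "sat A (Eql s t) = (\<lambda>e. eval_trm A e s = eval_trm A e t)"
| "sat A (Rel r ts) = (\<lambda>e. rel_int A r (map (eval_trm A e) ts))"
| "sat A (Neg \<phi>) = (\<lambda>e. \<not> sat A \<phi> e)"
| "sat A (CConj \<Phi>) = (\<lambda>e. \<forall>s \<in> rcset (cimage (sat A) \<Phi>). s e)"
| "sat A (CDisj \<Phi>) = (\<lambda>e. \<exists>s \<in> rcset (cimage (sat A) \<Phi>). s e)"
| "sat A (FEx x \<phi>) = (\<lambda>e. \<exists>a \<in> univ A. sat A \<phi> (e(x := a)))"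
| "sat A (FAll x \<phi>) = (\<lambda>e. \<forall>a \<in> univ A. sat A \<phi> (e(x := a)))"

lemma sat_CConj: "sat A (CConj \<Phi>) e \<longleftrightarrow> (\<forall>\<phi> \<in> rcset \<Phi>. sat A \<phi> e)"
  by (simp add: cimage.rep_eq)

lemma sat_CDisj: "sat A (CDisj \<Phi>) e \<longleftrightarrow> (\<exists>\<phi> \<in> rcset \<Phi>. sat A \<phi> e)"
  by (simp add: cimage.rep_eq)

definition sentence :: "('f, 'r) lang \<Rightarrow> ('f, 'r) fm \<Rightarrow> bool" where
  "sentence L \<phi> \<longleftrightarrow> wf_fm L \<phi> \<and> fv \<phi> = {}"

definition models :: "('f, 'r, 'a) struct \<Rightarrow> ('f, 'r) fm \<Rightarrow> bool" where
  "models A \<phi> \<longleftrightarrow> (\<forall>e. range e \<subseteq> univ A \<longrightarrow> sat A \<phi> e)"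

inductive finitary_qf :: "('f, 'r) fm \<Rightarrow> bool" where
  "finitary_qf (Eql s t)"
| "finitary_qf (Rel r ts)"
| "finitary_qf \<phi> \<Longrightarrow> finitary_qf (Neg \<phi>)"
| "finite (rcset \<Phi>) \<Longrightarrow> (\<And>\<phi>. \<phi> \<in> rcset \<Phi> \<Longrightarrow> finitary_qf \<phi>) \<Longrightarrow> finitary_qf (CConj \<Phi>)"
| "finite (rcset \<Phi>) \<Longrightarrow> (\<And>\<phi>. \<phi> \<in> rcset \<Phi> \<Longrightarrow> finitary_qf \<phi>) \<Longrightarrow> finitary_qf (CDisj \<Phi>)"

abbreviation Exs :: "nat list \<Rightarrow> ('f, 'r) fm \<Rightarrow> ('f, 'r) fm" where
  "Exs xs \<phi> \<equiv> foldr FEx xs \<phi>"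

abbreviation Alls :: "nat list \<Rightarrow> ('f, 'r) fm \<Rightarrow> ('f, 'r) fm" where
  "Alls xs \<phi> \<equiv> foldr FAll xs \<phi>"

definition sigma2_sentence :: "('f, 'r) lang \<Rightarrow> ('f, 'r) fm \<Rightarrow> bool" where
  "sigma2_sentence L \<phi> \<longleftrightarrow> sentence L \<phi> \<and>
     (\<exists>\<Psi>. \<phi> = CDisj \<Psi> \<and>
       (\<forall>\<psi> \<in> rcset \<Psi>. \<exists>xs X. \<psi> = Exs xs (CConj X) \<and>
         (\<forall>\<chi> \<in> rcset X. \<exists>ys \<theta>. \<chi> = Alls ys \<theta> \<and> finitary_qf \<theta>)))"

definition pi2_sentence :: "('f, 'r) lang \<Rightarrow> ('f, 'r) fm \<Rightarrow> bool" where
  "pi2_sentence L \<phi> \<longleftrightarrow> sentence L \<phi> \<and>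
     (\<exists>\<Psi>. \<phi> = CConj \<Psi> \<and>
       (\<forall>\<psi> \<in> rcset \<Psi>. \<exists>xs X. \<psi> = Alls xs (CDisj X) \<and>
         (\<forall>\<chi> \<in> rcset X. \<exists>ys \<theta>. \<chi> = Exs ys \<theta> \<and> finitary_qf \<theta>)))"

definition Th2 :: "('f, 'r) lang \<Rightarrow> ('f, 'r, 'a) struct \<Rightarrow> ('f, 'r) fm set" where
  "Th2 L A = {\<phi>. (sigma2_sentence L \<phi> \<or> pi2_sentence L \<phi>) \<and> models A \<phi>}"

text \<open>The competitor \<open>B\<close> lives on the same type \<^typ>\<open>'a\<close> as \<open>A\<close>. For a countable language and
  \<^typ>\<open>'a\<close> infinite this is no restriction, since a finitely generated structure is then countable
  and so isomorphic to one with universe a subset of \<^typ>\<open>'a\<close>.\<close>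

definition Th2_quasi_categorical :: "('f, 'r) lang \<Rightarrow> ('f, 'r, 'a) struct \<Rightarrow> bool" where
  "Th2_quasi_categorical L A \<longleftrightarrow>
     (\<forall>B :: ('f, 'r, 'a) struct. is_struct L B \<and> finitely_generated L B \<and>
        (\<forall>\<phi> \<in> Th2 L A. models B \<phi>) \<longrightarrow> isomorphic L A B)"

end

theory Submission
  imports Defs
begin

text \<open>If \<open>A\<close> and \<open>B\<close> embed into each other by \<open>\<Sigma>\<^sub>1\<close>-elementary maps, they satisfy the same
  \<open>\<Sigma>\<^sub>2\<close> and \<open>\<Pi>\<^sub>2\<close> sentences. To obtain such a pair, take the elements \<open>(k, w)\<close> with \<open>w\<close> a finite word
  over the natural numbers. They form a forest in which \<open>(k, w)\<close> has the children \<open>(k, n # w)\<close>,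
  given by the functions \<open>h\<^sub>n\<close>, and in which the root \<open>(k, [])\<close> is also a child of \<open>(k + 1, [])\<close>; a
  function \<open>f\<close> gives the parent. Everything is generated by \<open>(0, [])\<close>. When only finitely many
  \<open>h\<^sub>n\<close> are seen, the special child \<open>(k, [])\<close> of \<open>(k + 1, [])\<close> looks like the ordinary child
  \<open>(k + 1, [M])\<close> with \<open>M\<close> large, so the elements with \<open>k \<ge> 1\<close> form a \<open>\<Sigma>\<^sub>1\<close>-elementary
  substructure. Colouring the levels of the tree alternately, \<open>A\<close> and \<open>B\<close> are the
  two structures that differ in the colour of the generator. They are not isomorphic because
  the generator is the only element \<open>x\<close> outside the ranges of all \<open>h\<^sub>n\<close> such that
  every \<open>y\<close> with \<open>f y = x\<close> lies in one of these ranges.\<close>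

section \<open>Elementarity for existential formulas\<close>

definition restrict_funs :: "('f, 'r) lang \<Rightarrow> 'f set \<Rightarrow> ('f, 'r) lang" where
  "restrict_funs L K = L\<lparr>fun_arity := (\<lambda>f. if f \<in> K then fun_arity L f else None)\<rparr>"

lemma restrict_funs_simps [simp]:
  "fun_arity (restrict_funs L K) f = (if f \<in> K then fun_arity L f else None)"
  "rel_arity (restrict_funs L K) = rel_arity L"
  by (simp_all add: restrict_funs_def)

lemma wf_trm_restrict_mono:
  "wf_trm (restrict_funs L K) t \<Longrightarrow> K \<subseteq> K' \<Longrightarrow> wf_trm (restrict_funs L K') t"
  by (induction rule: wf_trm.induct) (auto intro!: wf_trm.intros split: if_splits)

lemma wf_fm_restrict_mono:
  "wf_fm (restrict_funs L K) \<phi> \<Longrightarrow> K \<subseteq> K' \<Longrightarrow> wf_fm (restrict_funs L K') \<phi>"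
  by (induction rule: wf_fm.induct) (auto intro!: wf_fm.intros intro: wf_trm_restrict_mono)

lemma finite_common_restriction:
  assumes "finite X"
    and "\<And>x. x \<in> X \<Longrightarrow> \<exists>K. finite K \<and> P K x"
    and mono: "\<And>K K' x. P K x \<Longrightarrow> K \<subseteq> K' \<Longrightarrow> P K' x"
  shows "\<exists>K. finite K \<and> (\<forall>x \<in> X. P K x)"
proof -
  obtain k where k: "\<And>x. x \<in> X \<Longrightarrow> finite (k x) \<and> P (k x) x"
    using assms(2) by metis
  have "finite (\<Union>x\<in>X. k x)" using assms(1) k by blast
  moreover have "\<forall>x \<in> X. P (\<Union>x\<in>X. k x) x" using k mono by (meson UN_upper)
  ultimately show ?thesis by blast
qed

lemma wf_trm_finite_restriction:
  "wf_trm L t \<Longrightarrow> \<exists>K. finite K \<and> wf_trm (restrict_funs L K) t"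
proof (induction rule: wf_trm.induct)
  case (1 x)
  show ?case by (auto intro: wf_trm.intros)
next
  case (2 f ts)
  obtain K where K: "finite K" "\<forall>t \<in> set ts. wf_trm (restrict_funs L K) t"
    using finite_common_restriction[of "set ts" "\<lambda>K. wf_trm (restrict_funs L K)"]
      2(3) wf_trm_restrict_mono by (metis List.finite_set)
  have "wf_trm (restrict_funs L (insert f K)) (App f ts)"
    using K 2(1) by (auto intro!: wf_trm.intros intro: wf_trm_restrict_mono)
  then show ?case using K(1) by blast
qed

text \<open>Terms contain finitely many function symbols, and the conjunctions and disjunctions in
  \<open>\<theta>\<close> are finite, so the union of the symbol sets stays finite.\<close>

lemma wf_fm_finite_restriction:
  "finitary_qf \<theta> \<Longrightarrow> wf_fm L \<theta> \<Longrightarrow> \<exists>K. finite K \<and> wf_fm (restrict_funs L K) \<theta>"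
proof (induction rule: finitary_qf.induct)
  case (1 s t)
  then have "wf_trm L s" "wf_trm L t" by (auto elim: wf_fm.cases)
  then obtain K K' where "finite K" "wf_trm (restrict_funs L K) s"
    "finite K'" "wf_trm (restrict_funs L K') t"
    using wf_trm_finite_restriction by metis
  then show ?case
    by (intro exI[of _ "K \<union> K'"]) (auto intro!: wf_fm.intros intro: wf_trm_restrict_mono)
next
  case (2 r ts)
  then have wf: "rel_arity L r = Some (length ts)" "\<And>t. t \<in> set ts \<Longrightarrow> wf_trm L t"
    by (auto elim: wf_fm.cases)
  obtain K where "finite K" "\<forall>t \<in> set ts. wf_trm (restrict_funs L K) t"
    using finite_common_restriction[of "set ts" "\<lambda>K. wf_trm (restrict_funs L K)"]
      wf(2) wf_trm_finite_restriction wf_trm_restrict_mono by (metis List.finite_set)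
  then show ?case using wf(1) by (auto intro!: wf_fm.intros)
next
  case (3 \<phi>)
  then have "wf_fm L \<phi>" by (auto elim: wf_fm.cases)
  then show ?case using 3 by (auto intro!: wf_fm.intros)
next
  case (4 \<Phi>)
  then have "\<And>\<phi>. \<phi> \<in> rcset \<Phi> \<Longrightarrow> wf_fm L \<phi>" by (auto elim: wf_fm.cases)
  then obtain K where "finite K" "\<forall>\<phi> \<in> rcset \<Phi>. wf_fm (restrict_funs L K) \<phi>"
    using finite_common_restriction[of "rcset \<Phi>" "\<lambda>K. wf_fm (restrict_funs L K)"]
      4 wf_fm_restrict_mono by metis
  then show ?case by (auto intro!: wf_fm.intros)
next
  case (5 \<Phi>)
  then have "\<And>\<phi>. \<phi> \<in> rcset \<Phi> \<Longrightarrow> wf_fm L \<phi>" by (auto elim: wf_fm.cases)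
  then obtain K where "finite K" "\<forall>\<phi> \<in> rcset \<Phi>. wf_fm (restrict_funs L K) \<phi>"
    using finite_common_restriction[of "rcset \<Phi>" "\<lambda>K. wf_fm (restrict_funs L K)"]
      5 wf_fm_restrict_mono by metis
  then show ?case by (auto intro!: wf_fm.intros)
qed

section \<open>Partial embeddings and quantifier-free formulas\<close>

text \<open>With a restricted language for \<open>L\<close>, \<open>D\<close> may be a part of
  \<open>B\<close> that the omitted functions lead out of.\<close>

definition partial_embedding ::
    "('f, 'r) lang \<Rightarrow> ('f, 'r, 'b) struct \<Rightarrow> ('f, 'r, 'a) struct \<Rightarrow> 'b set \<Rightarrow> ('b \<Rightarrow> 'a) \<Rightarrow> bool" where
  "partial_embedding L B A D h \<longleftrightarrow> inj_on h D \<and>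
     (\<forall>f as. fun_arity L f = Some (length as) \<and> set as \<subseteq> D \<longrightarrow>
        fun_int B f as \<in> D \<and> h (fun_int B f as) = fun_int A f (map h as)) \<and>
     (\<forall>r as. rel_arity L r = Some (length as) \<and> set as \<subseteq> D \<longrightarrow>
        (rel_int B r as \<longleftrightarrow> rel_int A r (map h as)))"

lemma partial_embedding_eval_trm:
  assumes emb: "partial_embedding L B A D h"
  shows "wf_trm L t \<Longrightarrow> \<forall>x \<in> fv_trm t. e x \<in> D \<and> e' x = h (e x) \<Longrightarrow>
    eval_trm B e t \<in> D \<and> h (eval_trm B e t) = eval_trm A e' t"
proof (induction rule: wf_trm.induct)
  case (1 x)
  then show ?case by simp
next
  case (2 f ts)
  have IH: "\<And>t. t \<in> set ts \<Longrightarrow> eval_trm B e t \<in> D \<and> h (eval_trm B e t) = eval_trm A e' t"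
    using 2(3,4) by auto
  then have "map h (map (eval_trm B e) ts) = map (eval_trm A e') ts" by simp
  moreover have "set (map (eval_trm B e) ts) \<subseteq> D" using IH by auto
  moreover have "fun_arity L f = Some (length (map (eval_trm B e) ts))" using 2(1) by simp
  ultimately show ?case using emb unfolding partial_embedding_def eval_trm.simps by metis
qed

lemma partial_embedding_sat:
  assumes emb: "partial_embedding L B A D h"
  shows "finitary_qf \<theta> \<Longrightarrow> wf_fm L \<theta> \<Longrightarrow> \<forall>x \<in> fv \<theta>. e x \<in> D \<and> e' x = h (e x) \<Longrightarrow>
    sat B \<theta> e \<longleftrightarrow> sat A \<theta> e'"
proof (induction rule: finitary_qf.induct)
  case (1 s t)
  then have "wf_trm L s" "wf_trm L t" by (auto elim: wf_fm.cases)
  then have "eval_trm B e s \<in> D \<and> h (eval_trm B e s) = eval_trm A e' s"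
    "eval_trm B e t \<in> D \<and> h (eval_trm B e t) = eval_trm A e' t"
    using 1(2) partial_embedding_eval_trm[OF emb, of _ e e'] by simp_all
  then show ?case using emb by (simp add: partial_embedding_def) (metis inj_onD)
next
  case (2 r ts)
  then have wf: "rel_arity L r = Some (length ts)" "\<And>t. t \<in> set ts \<Longrightarrow> wf_trm L t"
    by (auto elim: wf_fm.cases)
  have ev: "\<And>t. t \<in> set ts \<Longrightarrow> eval_trm B e t \<in> D \<and> h (eval_trm B e t) = eval_trm A e' t"
    using 2(2) wf(2) partial_embedding_eval_trm[OF emb, of _ e e'] by auto
  then have "map h (map (eval_trm B e) ts) = map (eval_trm A e') ts" by simp
  moreover have "set (map (eval_trm B e) ts) \<subseteq> D" using ev by auto
  moreover have "rel_arity L r = Some (length (map (eval_trm B e) ts))" using wf(1) by simp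
  ultimately show ?case using emb unfolding partial_embedding_def sat.simps by metis
next
  case (3 \<phi>)
  then have "wf_fm L \<phi>" by (auto elim: wf_fm.cases)
  then show ?case using 3 by simp
next
  case (4 \<Phi>)
  then have "\<And>\<phi>. \<phi> \<in> rcset \<Phi> \<Longrightarrow> wf_fm L \<phi>" by (auto elim: wf_fm.cases)
  moreover have "\<And>\<phi> x. \<phi> \<in> rcset \<Phi> \<Longrightarrow> x \<in> fv \<phi> \<Longrightarrow> e x \<in> D \<and> e' x = h (e x)"
    using 4(5) by (auto simp: cimage.rep_eq)
  ultimately show ?case using 4(3) by (simp add: sat_CConj del: sat.simps)
next
  case (5 \<Phi>)
  then have "\<And>\<phi>. \<phi> \<in> rcset \<Phi> \<Longrightarrow> wf_fm L \<phi>" by (auto elim: wf_fm.cases)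
  moreover have "\<And>\<phi> x. \<phi> \<in> rcset \<Phi> \<Longrightarrow> x \<in> fv \<phi> \<Longrightarrow> e x \<in> D \<and> e' x = h (e x)"
    using 5(5) by (auto simp: cimage.rep_eq)
  ultimately show ?case using 5(3) by (simp add: sat_CDisj del: sat.simps)
qed

lemma finite_fv_trm: "finite (fv_trm t)"
  by (induction t) auto

lemma finite_fv: "finitary_qf \<theta> \<Longrightarrow> finite (fv \<theta>)"
  by (induction rule: finitary_qf.induct) (auto simp: finite_fv_trm cimage.rep_eq)

section \<open>Blocks of quantifiers\<close>

lemma sat_Exs:
  "sat A (Exs xs \<phi>) e \<longleftrightarrow>
    (\<exists>e'. (\<forall>x. if x \<in> set xs then e' x \<in> univ A else e' x = e x) \<and> sat A \<phi> e')"
proof (induction xs arbitrary: e)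
  case Nil
  have "(\<forall>x. e' x = e x) \<longleftrightarrow> e' = e" for e' by auto
  then show ?case by simp
next
  case (Cons x xs)
  show ?case
  proof
    assume "sat A (Exs (x # xs) \<phi>) e"
    then obtain a where a: "a \<in> univ A" "sat A (Exs xs \<phi>) (e(x := a))" by auto
    then obtain e' where e': "\<forall>y. if y \<in> set xs then e' y \<in> univ A else e' y = (e(x := a)) y"
      "sat A \<phi> e'" using Cons.IH by metis
    have "\<forall>y. if y \<in> set (x # xs) then e' y \<in> univ A else e' y = e y"
    proof
      fix y
      show "if y \<in> set (x # xs) then e' y \<in> univ A else e' y = e y"
        using e'(1)[rule_format, of y] a(1) by (auto split: if_splits)
    qed
    then show "\<exists>e'. (\<forall>y. if y \<in> set (x # xs) then e' y \<in> univ A else e' y = e y) \<and> sat A \<phi> e'"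
      using e'(2) by blast
  next
    assume "\<exists>e'. (\<forall>y. if y \<in> set (x # xs) then e' y \<in> univ A else e' y = e y) \<and> sat A \<phi> e'"
    then obtain e' where e': "\<forall>y. if y \<in> set (x # xs) then e' y \<in> univ A else e' y = e y"
      "sat A \<phi> e'" by blast
    \<comment> \<open>The outermost quantifier receives the final value of \<open>x\<close>, even if
      \<open>x\<close> is bound again in \<open>xs\<close>.\<close>
    have "\<forall>y. if y \<in> set xs then e' y \<in> univ A else e' y = (e(x := e' x)) y"
    proof
      fix y
      show "if y \<in> set xs then e' y \<in> univ A else e' y = (e(x := e' x)) y"
        using e'(1)[rule_format, of y] by (auto split: if_splits)
    qed
    then have "sat A (Exs xs \<phi>) (e(x := e' x))" using Cons.IH e'(2) by blast
    moreover have "e' x \<in> univ A" using e'(1)[rule_format, of x] by simp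
    ultimately show "sat A (Exs (x # xs) \<phi>) e" by auto
  qed
qed

lemma sat_Alls: "sat A (Alls xs \<phi>) e \<longleftrightarrow> \<not> sat A (Exs xs (Neg \<phi>)) e"
  by (induction xs arbitrary: e) auto

lemma fv_Exs: "fv (Exs xs \<phi>) = fv \<phi> - set xs"
  by (induction xs) auto

lemma fv_Alls: "fv (Alls xs \<phi>) = fv \<phi> - set xs"
  by (induction xs) auto

lemma wf_fm_Exs: "wf_fm L (Exs xs \<phi>) \<Longrightarrow> wf_fm L \<phi>"
  by (induction xs) (auto elim: wf_fm.cases)

lemma wf_fm_Alls: "wf_fm L (Alls xs \<phi>) \<Longrightarrow> wf_fm L \<phi>"
  by (induction xs) (auto elim: wf_fm.cases)

text \<open>The local retractions make \<open>g\<close> elementary for existential formulas: a finite configuration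
  in \<open>B\<close> over the image of \<open>g\<close> is copied back to \<open>A\<close>, as far as finitely many function symbols
  can see.\<close>

definition locally_retractable ::
    "('f, 'r) lang \<Rightarrow> ('f, 'r, 'a) struct \<Rightarrow> ('f, 'r, 'b) struct \<Rightarrow> ('a \<Rightarrow> 'b) \<Rightarrow> bool" where
  "locally_retractable L A B g \<longleftrightarrow> g ` univ A \<subseteq> univ B \<and>
     (\<forall>F K. finite F \<and> F \<subseteq> univ B \<and> finite K \<longrightarrow>
       (\<exists>D h. F \<subseteq> D \<and> h ` D \<subseteq> univ A \<and> partial_embedding (restrict_funs L K) B A D h \<and>
          (\<forall>a \<in> univ A. g a \<in> D \<longrightarrow> h (g a) = a)))"

text \<open>A witnessing assignment in \<open>B\<close> involves finitely many elements and
  \<open>\<theta>\<close> finitely many symbols, so a local retraction carries it to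
  \<open>A\<close>. It returns each parameter \<open>g (e x)\<close> to \<open>e x\<close>.\<close>

lemma sat_Exs_reflect:
  assumes g: "locally_retractable L A B g"
    and \<theta>: "finitary_qf \<theta>" "wf_fm L \<theta>"
    and e: "\<And>x. x \<in> fv \<theta> - set ys \<Longrightarrow> e x \<in> univ A \<and> e' x = g (e x)"
    and ne: "univ A \<noteq> {}"
    and sat: "sat B (Exs ys \<theta>) e'"
  shows "sat A (Exs ys \<theta>) e"
proof -
  obtain d where d: "\<And>x. if x \<in> set ys then d x \<in> univ B else d x = e' x" and dsat: "sat B \<theta> d"
    using sat unfolding sat_Exs by blast
  obtain K where K: "finite K" "wf_fm (restrict_funs L K) \<theta>"
    using wf_fm_finite_restriction[OF \<theta>] by blast
  have "d x \<in> univ B" if "x \<in> fv \<theta>" for x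
    using d[of x] e[of x] g that by (auto simp: locally_retractable_def split: if_splits)
  then have F: "finite (d ` fv \<theta>)" "d ` fv \<theta> \<subseteq> univ B"
    using finite_fv[OF \<theta>(1)] by auto
  then have "\<exists>D h. d ` fv \<theta> \<subseteq> D \<and> h ` D \<subseteq> univ A \<and>
      partial_embedding (restrict_funs L K) B A D h \<and> (\<forall>a \<in> univ A. g a \<in> D \<longrightarrow> h (g a) = a)"
    using g K(1) unfolding locally_retractable_def by simp
  then obtain D h where D: "d ` fv \<theta> \<subseteq> D" "h ` D \<subseteq> univ A"
    and emb: "partial_embedding (restrict_funs L K) B A D h"
    and ret: "\<And>a. a \<in> univ A \<Longrightarrow> g a \<in> D \<Longrightarrow> h (g a) = a"
    by blast
  \<comment> \<open>\<open>a\<close> is the default for quantified variables not free in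
    \<open>\<theta>\<close>: their values under \<open>d\<close> may lie outside \<open>D\<close>,
    where \<open>h\<close> is uncontrolled.\<close>
  obtain a where a: "a \<in> univ A" using ne by blast
  define c where
    "c x = (if x \<in> set ys then (if x \<in> fv \<theta> then h (d x) else a) else e x)" for x
  have "c x = h (d x)" if "x \<in> fv \<theta>" for x
    using that d[of x] e[of x] ret[of "e x"] D(1) by (auto simp: c_def split: if_splits)
  then have "sat A \<theta> c"
    using partial_embedding_sat[OF emb \<theta>(1) K(2), of d c] dsat D(1) by blast
  moreover have "\<forall>x. if x \<in> set ys then c x \<in> univ A else c x = e x"
    using a D by (auto simp: c_def)
  ultimately show ?thesis using sat_Exs by blast
qed

lemma sat_Alls_preserve:
  assumes "locally_retractable L A B g" "finitary_qf \<theta>" "wf_fm L \<theta>"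
    and "\<And>x. x \<in> fv \<theta> - set ys \<Longrightarrow> e x \<in> univ A \<and> e' x = g (e x)"
    and "univ A \<noteq> {}" "sat A (Alls ys \<theta>) e"
  shows "sat B (Alls ys \<theta>) e'"
proof -
  have "finitary_qf (Neg \<theta>)" "wf_fm L (Neg \<theta>)"
    using assms(2,3) by (auto intro: finitary_qf.intros wf_fm.intros)
  then show ?thesis
    using assms(4-6) sat_Exs_reflect[OF assms(1), of "Neg \<theta>" ys e e']
    unfolding sat_Alls fv.simps by blast
qed

section \<open>Transfer of \<Sigma>_2 and \<Pi>_2 sentences\<close>

text \<open>The witnesses of the outer block move along \<open>g\<close>. The universal formulas
  about them survive, since a counterexample in \<open>B\<close> would be reflected to
  \<open>A\<close>.\<close>

lemma sigma2_preserve: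
  assumes g: "locally_retractable L A B g" and ne: "univ A \<noteq> {}"
    and \<phi>: "sigma2_sentence L \<phi>" "models A \<phi>"
  shows "models B \<phi>"
  unfolding models_def
proof (intro allI impI)
  fix eB :: "nat \<Rightarrow> _"
  obtain \<Psi> where \<Psi>: "\<phi> = CDisj \<Psi>" "\<forall>\<psi> \<in> rcset \<Psi>. \<exists>xs X. \<psi> = Exs xs (CConj X) \<and>
         (\<forall>\<chi> \<in> rcset X. \<exists>ys \<theta>. \<chi> = Alls ys \<theta> \<and> finitary_qf \<theta>)"
    using \<phi>(1) unfolding sigma2_sentence_def by (elim conjE exE) (rule that)
  \<comment> \<open>Nonemptiness of \<open>A\<close> provides an assignment, without which
    \<open>models A \<phi>\<close> would be vacuous.\<close>
  obtain a where "a \<in> univ A" using ne by blast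
  then have "sat A \<phi> (\<lambda>_. a)" using \<phi>(2) by (auto simp: models_def)
  then obtain \<psi> where \<psi>: "\<psi> \<in> rcset \<Psi>" "sat A \<psi> (\<lambda>_. a)"
    unfolding \<Psi>(1) sat_CDisj by blast
  obtain xs X where X: "\<psi> = Exs xs (CConj X)"
    "\<forall>\<chi> \<in> rcset X. \<exists>ys \<theta>. \<chi> = Alls ys \<theta> \<and> finitary_qf \<theta>"
    using bspec[OF \<Psi>(2) \<psi>(1)] by (elim exE conjE) (rule that)
  obtain d where d: "\<And>x. if x \<in> set xs then d x \<in> univ A else d x = a" "sat A (CConj X) d"
    using \<psi>(2) unfolding X(1) sat_Exs by blast
  have sent: "wf_fm L (CDisj \<Psi>)" "fv (CDisj \<Psi>) = {}"
    using \<phi>(1) unfolding sigma2_sentence_def sentence_def \<Psi>(1) by blast+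
  have "wf_fm L \<psi>" using sent(1) \<psi>(1) by (auto elim: wf_fm.cases)
  then have "wf_fm L (CConj X)" unfolding X(1) by (rule wf_fm_Exs)
  then have wf: "\<And>\<chi>. \<chi> \<in> rcset X \<Longrightarrow> wf_fm L \<chi>" by (auto elim: wf_fm.cases)
  have "fv \<psi> = {}" using sent(2) \<psi>(1) by (auto simp: cimage.rep_eq)
  then have fv: "\<And>\<chi>. \<chi> \<in> rcset X \<Longrightarrow> fv \<chi> \<subseteq> set xs"
    unfolding X(1) fv_Exs by (auto simp: cimage.rep_eq)
  \<comment> \<open>Outside \<open>xs\<close> the given \<open>eB\<close> has to be kept. Its values
    do not matter to any \<open>\<chi>\<close>, whose free variables lie in \<open>xs\<close>
    because \<open>\<phi>\<close> is a sentence.\<close>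
  define c where "c x = (if x \<in> set xs then g (d x) else eB x)" for x
  have "sat B \<chi> c" if \<chi>: "\<chi> \<in> rcset X" for \<chi>
  proof -
    obtain ys \<theta> where \<theta>: "\<chi> = Alls ys \<theta>" "finitary_qf \<theta>" using bspec[OF X(2) \<chi>] by blast
    have "sat A (Alls ys \<theta>) d" using d(2) \<chi> \<theta>(1) unfolding sat_CConj by blast
    moreover have "wf_fm L \<theta>" using wf[OF \<chi>] \<theta>(1) wf_fm_Alls by blast
    moreover have "d x \<in> univ A \<and> c x = g (d x)" if "x \<in> fv \<theta> - set ys" for x
    proof -
      have "x \<in> set xs" using fv[OF \<chi>] that unfolding \<theta>(1) fv_Alls by blast
      then show ?thesis using d(1)[of x] by (simp add: c_def)
    qed
    ultimately show ?thesis unfolding \<theta>(1) using sat_Alls_preserve[OF g \<theta>(2)] ne by blast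
  qed
  then have "sat B (CConj X) c" unfolding sat_CConj by blast
  moreover have "\<forall>x. if x \<in> set xs then c x \<in> univ B else c x = eB x"
  proof
    fix x
    show "if x \<in> set xs then c x \<in> univ B else c x = eB x"
      using d(1)[of x] g by (auto simp: c_def locally_retractable_def)
  qed
  ultimately have "sat B \<psi> eB" unfolding X(1) sat_Exs by blast
  then show "sat B \<phi> eB" unfolding \<Psi>(1) sat_CDisj using \<psi>(1) by blast
qed

text \<open>A choice for the outer universal block in \<open>A\<close> is sent to \<open>B\<close>
  by \<open>g\<close>; an existential disjunct true there comes back by
  \<open>sat_Exs_reflect\<close>.\<close>

lemma pi2_reflect:
  assumes g: "locally_retractable L A B g" and ne: "univ A \<noteq> {}"
    and \<phi>: "pi2_sentence L \<phi>" "models B \<phi>"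
  shows "models A \<phi>"
  unfolding models_def
proof (intro allI impI)
  fix eA :: "nat \<Rightarrow> _" assume eA: "range eA \<subseteq> univ A"
  obtain \<Psi> where \<Psi>: "\<phi> = CConj \<Psi>" "\<forall>\<psi> \<in> rcset \<Psi>. \<exists>xs X. \<psi> = Alls xs (CDisj X) \<and>
         (\<forall>\<chi> \<in> rcset X. \<exists>ys \<theta>. \<chi> = Exs ys \<theta> \<and> finitary_qf \<theta>)"
    using \<phi>(1) unfolding pi2_sentence_def by (elim conjE exE) (rule that)
  have "sat A \<psi> eA" if \<psi>: "\<psi> \<in> rcset \<Psi>" for \<psi>
  proof -
    obtain xs X where X: "\<psi> = Alls xs (CDisj X)"
      "\<forall>\<chi> \<in> rcset X. \<exists>ys \<theta>. \<chi> = Exs ys \<theta> \<and> finitary_qf \<theta>"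
      using bspec[OF \<Psi>(2) \<psi>] by (elim exE conjE) (rule that)
    have sent: "wf_fm L (CConj \<Psi>)" "fv (CConj \<Psi>) = {}"
      using \<phi>(1) unfolding pi2_sentence_def sentence_def \<Psi>(1) by blast+
    have "wf_fm L \<psi>" using sent(1) \<psi> by (auto elim: wf_fm.cases)
    then have "wf_fm L (CDisj X)" unfolding X(1) by (rule wf_fm_Alls)
    then have wf: "\<And>\<chi>. \<chi> \<in> rcset X \<Longrightarrow> wf_fm L \<chi>" by (auto elim: wf_fm.cases)
    have "fv \<psi> = {}" using sent(2) \<psi> by (auto simp: cimage.rep_eq)
    then have fv: "\<And>\<chi>. \<chi> \<in> rcset X \<Longrightarrow> fv \<chi> \<subseteq> set xs"
      unfolding X(1) fv_Alls by (auto simp: cimage.rep_eq)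
    have "sat A (CDisj X) d" if d: "\<forall>x. if x \<in> set xs then d x \<in> univ A else d x = eA x" for d
    proof -
      have dA: "d x \<in> univ A" for x using d eA by (metis range_subsetD)
      then have "range (g \<circ> d) \<subseteq> univ B" using g by (auto simp: locally_retractable_def)
      then have "sat B \<psi> (g \<circ> d)" using \<phi>(2) \<psi> unfolding models_def \<Psi>(1) sat_CConj by blast
      \<comment> \<open>Each quantifier of the block is instantiated with the value that its
        variable already has under \<open>g \<circ> d\<close>.\<close>
      moreover have "\<forall>x. if x \<in> set xs then (g \<circ> d) x \<in> univ B else (g \<circ> d) x = (g \<circ> d) x"
        using \<open>range (g \<circ> d) \<subseteq> univ B\<close> by auto
      ultimately have "sat B (CDisj X) (g \<circ> d)"
        unfolding X(1) sat_Alls sat_Exs sat.simps(3) by blast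
      then obtain \<chi> where \<chi>: "\<chi> \<in> rcset X" "sat B \<chi> (g \<circ> d)" unfolding sat_CDisj by blast
      obtain ys \<theta> where \<theta>: "\<chi> = Exs ys \<theta>" "finitary_qf \<theta>" using bspec[OF X(2) \<chi>(1)] by blast
      have "wf_fm L \<theta>" using wf[OF \<chi>(1)] \<theta>(1) wf_fm_Exs by blast
      then have "sat A \<chi> d"
        using sat_Exs_reflect[OF g \<theta>(2), of ys d "g \<circ> d"] dA ne \<chi>(2) \<theta>(1) by simp
      then show ?thesis unfolding sat_CDisj using \<chi>(1) by blast
    qed
    then show ?thesis unfolding X(1) sat_Alls sat_Exs sat.simps(3) by blast
  qed
  then show "sat A \<phi> eA" unfolding \<Psi>(1) sat_CConj by blast
qed

text \<open>\<Sigma>_2 sentences travel forwards along \<open>g\<close>, \<Pi>_2 sentences backwards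
  along \<open>g'\<close>.\<close>

lemma Th2_subset:
  assumes "locally_retractable L A B g" "locally_retractable L B A g'"
    and "univ A \<noteq> {}" "univ B \<noteq> {}" "\<phi> \<in> Th2 L A"
  shows "models B \<phi>"
  using assms sigma2_preserve pi2_reflect unfolding Th2_def by blast

section \<open>Two coloured trees\<close>

text \<open>The coding is bijective, so the universe can be all of the naturals.\<close>

definition node :: "nat \<Rightarrow> nat list \<Rightarrow> nat" where
  "node k w = prod_encode (k, list_encode w)"

definition root_index :: "nat \<Rightarrow> nat" where
  "root_index x = fst (prod_decode x)"

definition word :: "nat \<Rightarrow> nat list" where
  "word x = list_decode (snd (prod_decode x))"

lemma node_simps [simp]:
  "root_index (node k w) = k" "word (node k w) = w" "node (root_index x) (word x) = x"
  by (simp_all add: node_def root_index_def word_def)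

lemma node_inject [simp]: "node k w = node k' w' \<longleftrightarrow> k = k' \<and> w = w'"
  by (metis node_simps(1,2))

lemma node_cases: obtains k w where "x = node k w"
  by (metis node_simps(3))

definition parent :: "nat \<Rightarrow> nat" where
  "parent x = (if word x = [] then node (Suc (root_index x)) []
     else node (root_index x) (tl (word x)))"

definition child :: "nat \<Rightarrow> nat \<Rightarrow> nat" where
  "child n x = node (root_index x) (n # word x)"

lemma parent_child_node [simp]:
  "parent (node k []) = node (Suc k) []"
  "parent (node k (n # w)) = node k w"
  "child n (node k w) = node k (n # w)"
  by (simp_all add: parent_def child_def)

definition tree_lang :: "(nat, nat) lang" where
  "tree_lang = \<lparr>fun_arity = (\<lambda>_. Some 1), rel_arity = [0 \<mapsto> 1]\<rparr>"

text \<open>The height of \<open>(k, w)\<close> is \<open>k - length w\<close>; the sum has the same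
  parity and stays in the naturals. Symbol \<open>0\<close> is the parent function, symbol
  \<open>Suc n\<close> is \<open>child n\<close>.\<close>

definition tree :: "bool \<Rightarrow> (nat, nat, nat) struct" where
  "tree b = \<lparr>univ = UNIV,
     fun_int = (\<lambda>f as. case f of 0 \<Rightarrow> parent (hd as) | Suc n \<Rightarrow> child n (hd as)),
     rel_int = (\<lambda>r as. even (root_index (hd as) + length (word (hd as))) = b)\<rparr>"

lemma univ_tree [simp]: "univ (tree b) = UNIV"
  by (simp add: tree_def)

lemma is_struct_tree: "is_struct tree_lang (tree b)"
  by (simp add: is_struct_def)

lemma finitely_generated_tree: "finitely_generated tree_lang (tree b)"
proof -
  let ?G = "generated tree_lang (tree b) {node 0 []}"
  have app: "fun_int (tree b) f [x] \<in> ?G" if "x \<in> ?G" for f x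
    using that by (auto intro: generated.app simp: tree_lang_def)
  have root: "node k [] \<in> ?G" for k
  proof (induction k)
    case 0
    show ?case by (simp add: generated.base)
  next
    case (Suc k)
    then show ?case using app[of _ 0] by (fastforce simp: tree_def)
  qed
  have "node k w \<in> ?G" for k w
  proof (induction w)
    case Nil
    show ?case by (rule root)
  next
    case (Cons n w)
    then show ?case using app[of _ "Suc n"] by (fastforce simp: tree_def)
  qed
  then have "?G = UNIV" by (metis UNIV_eq_I node_cases)
  then show ?thesis unfolding finitely_generated_def univ_tree
    by (intro exI[of _ "{node 0 []}"]) simp
qed

section \<open>The shift and its local retractions\<close>

definition shift :: "nat \<Rightarrow> nat" where
  "shift x = node (Suc (root_index x)) (word x)"

text \<open>On the range of \<open>shift\<close> this is its inverse. What remains is the subtree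
  rooted at \<open>(0, [])\<close>, the special child of \<open>(1, [])\<close>; it is moved to the
  subtree rooted at the ordinary child \<open>(0, [M])\<close> of \<open>(0, [])\<close>.
  \<open>M\<close> goes to the end because words list the latest step first.\<close>

definition retract :: "nat \<Rightarrow> nat \<Rightarrow> nat" where
  "retract M x = (case root_index x of 0 \<Rightarrow> node 0 (word x @ [M]) | Suc k \<Rightarrow> node k (word x))"

lemma retract_node [simp]:
  "retract M (node 0 w) = node 0 (w @ [M])" "retract M (node (Suc k) w) = node k w"
  by (simp_all add: retract_def)

lemma retract_shift: "retract M (shift x) = x"
  by (simp add: shift_def)

text \<open>The critical case is \<open>(0, [])\<close>: its parent \<open>(1, [])\<close> goes to
  \<open>(0, [])\<close>, which is also the parent of its image \<open>(0, [M])\<close>.\<close>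

lemma retract_parent: "retract M (parent x) = parent (retract M x)"
proof -
  obtain k w where x: "x = node k w" by (rule node_cases)
  show ?thesis by (cases k; cases w) (simp_all add: x)
qed

lemma retract_child: "retract M (child n x) = child n (retract M x)"
proof -
  obtain k w where x: "x = node k w" by (rule node_cases)
  show ?thesis by (cases k) (simp_all add: x)
qed

text \<open>Either the index drops by one or the word gains a letter. This reversal matches the
  opposite colourings of \<open>tree b\<close> and \<open>tree (\<not> b)\<close>.\<close>

lemma retract_parity:
  "even (root_index (retract M x) + length (word (retract M x))) \<longleftrightarrow>
    odd (root_index x + length (word x))"
proof -
  obtain k w where x: "x = node k w" by (rule node_cases)
  show ?thesis by (cases k) (simp_all add: x)
qed

text \<open>Only \<open>(0, w)\<close> and \<open>(1, w @ [M])\<close> can collide, and the latter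
  is excluded.\<close>

lemma inj_on_retract: "inj_on (retract M) {x. M \<notin> set (word x)}"
proof (rule inj_onI)
  fix x y assume "x \<in> {x. M \<notin> set (word x)}" "y \<in> {x. M \<notin> set (word x)}"
    and eq: "retract M x = retract M y"
  moreover obtain k w where x: "x = node k w" by (rule node_cases)
  moreover obtain l v where y: "y = node l v" by (rule node_cases)
  ultimately show "x = y" by (cases k; cases l) auto
qed

lemma word_parent: "set (word (parent x)) \<subseteq> set (word x)"
  by (auto simp: parent_def dest: list.set_sel(2))

text \<open>\<open>Suc M\<close> names \<open>child M\<close>, the only function leading out of the
  set of nodes whose words avoid \<open>M\<close>.\<close>

lemma partial_embedding_retract:
  assumes "Suc M \<notin> K"
  shows "partial_embedding (restrict_funs tree_lang K) (tree (\<not> b)) (tree b)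
    {x. M \<notin> set (word x)} (retract M)"
  unfolding partial_embedding_def
proof (intro conjI allI impI inj_on_retract)
  fix f and as :: "nat list"
  assume "fun_arity (restrict_funs tree_lang K) f = Some (length as) \<and>
    set as \<subseteq> {x. M \<notin> set (word x)}"
  then obtain x where x: "as = [x]" "f \<in> K" "M \<notin> set (word x)"
    by (cases as) (auto simp: tree_lang_def split: if_splits)
  show "fun_int (tree (\<not> b)) f as \<in> {x. M \<notin> set (word x)}"
    using x assms word_parent[of x] by (cases f) (auto simp: tree_def child_def)
  show "retract M (fun_int (tree (\<not> b)) f as) = fun_int (tree b) f (map (retract M) as)"
    by (cases f) (simp_all add: x tree_def retract_parent retract_child)
next
  fix r and as :: "nat list"
  assume "rel_arity (restrict_funs tree_lang K) r = Some (length as) \<and>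
    set as \<subseteq> {x. M \<notin> set (word x)}"
  then obtain x where x: "as = [x]"
    by (cases as) (auto simp: tree_lang_def split: if_splits)
  show "rel_int (tree (\<not> b)) r as = rel_int (tree b) r (map (retract M) as)"
    using retract_parity[of M x] by (auto simp: x tree_def)
qed

lemma locally_retractable_shift: "locally_retractable tree_lang (tree b) (tree (\<not> b)) shift"
  unfolding locally_retractable_def
proof (intro conjI allI impI)
  fix F K :: "nat set"
  assume "finite F \<and> F \<subseteq> univ (tree (\<not> b)) \<and> finite K"
  \<comment> \<open>\<open>M\<close> must occur in no word from \<open>F\<close>, and its symbol
    \<open>Suc M\<close> must lie outside \<open>K\<close>; the preimage under \<open>Suc\<close>
    turns both conditions into avoiding one finite set.\<close>
  then have "finite (K \<union> Suc ` (\<Union>x\<in>F. set (word x)))" by auto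
  then have "finite (Suc -` (K \<union> Suc ` (\<Union>x\<in>F. set (word x))))" by (auto intro: finite_vimageI)
  then obtain M where M: "M \<notin> Suc -` (K \<union> Suc ` (\<Union>x\<in>F. set (word x)))"
    using ex_new_if_finite infinite_UNIV_nat by blast
  show "\<exists>D h. F \<subseteq> D \<and> h ` D \<subseteq> univ (tree b) \<and>
      partial_embedding (restrict_funs tree_lang K) (tree (\<not> b)) (tree b) D h \<and>
      (\<forall>a \<in> univ (tree b). shift a \<in> D \<longrightarrow> h (shift a) = a)"
    using M partial_embedding_retract[of M K b]
    by (intro exI[of _ "{x. M \<notin> set (word x)}"] exI[of _ "retract M"])
      (auto simp: retract_shift)
qed simp

section \<open>Non-isomorphism of the two trees\<close>

lemma isomorphism_tree_generator:
  assumes bij: "bij h"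
    and parent: "\<And>x. h (parent x) = parent (h x)"
    and child: "\<And>n x. h (child n x) = child n (h x)"
  shows "h (node 0 []) = node 0 []"
proof -
  obtain k w where kw: "h (node 0 []) = node k w" by (rule node_cases)
  have "w = []"
  proof (cases w)
    \<comment> \<open>If the image were a child, bijectivity of \<open>h\<close> would make the
      generator itself a child.\<close>
    case (Cons n v)
    obtain y where "h y = node k v" using bij by (metis bij_pointE)
    then have "h (node 0 []) = h (child n y)" using kw Cons child by simp
    then have "node 0 [] = child n y" using bij by (meson bij_is_inj injD)
    then show ?thesis by (simp add: child_def)
  qed simp
  moreover have "k = 0"
  proof (cases k)
    \<comment> \<open>The special child \<open>(j, [])\<close> of the image is pulled back to a node
      \<open>y\<close> with the generator as parent.\<close>
    case (Suc j)
    obtain y where y: "h y = node j []" using bij by (metis bij_pointE)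
    then have "h (node 0 []) = h (parent y)" using kw Suc \<open>w = []\<close> parent by simp
    then have py: "node 0 [] = parent y" using bij by (meson bij_is_inj injD)
    obtain l v where v: "y = node l v" by (rule node_cases)
    \<comment> \<open>The generator has no special child, since a root \<open>(l, [])\<close> has
      parent \<open>(Suc l, [])\<close>. So \<open>y\<close> is an ordinary child, and
      \<open>h\<close> would make \<open>(j, [])\<close> one too, against its empty word.\<close>
    have "\<exists>n. y = child n (node 0 [])" using py by (cases v) (simp_all add: v)
    then obtain n where "y = child n (node 0 [])" ..
    then have "node j [] = child n (h (node 0 []))" using y child by metis
    then show ?thesis by (simp add: child_def)
  qed simp
  ultimately show ?thesis using kw by simp
qed

lemma not_isomorphic_tree: "\<not> isomorphic tree_lang (tree b) (tree (\<not> b))"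
proof
  assume "isomorphic tree_lang (tree b) (tree (\<not> b))"
  then obtain h where bij: "bij h"
    and funs: "\<And>f as. fun_arity tree_lang f = Some (length as) \<Longrightarrow>
      h (fun_int (tree b) f as) = fun_int (tree (\<not> b)) f (map h as)"
    and rels: "\<And>r as. rel_arity tree_lang r = Some (length as) \<Longrightarrow>
      rel_int (tree b) r as \<longleftrightarrow> rel_int (tree (\<not> b)) r (map h as)"
    unfolding isomorphic_def by auto
  have "h (parent x) = parent (h x)" for x
    using funs[of 0 "[x]"] by (simp add: tree_def tree_lang_def)
  moreover have "h (child n x) = child n (h x)" for n x
    using funs[of "Suc n" "[x]"] by (simp add: tree_def tree_lang_def)
  ultimately have "h (node 0 []) = node 0 []"
    by (rule isomorphism_tree_generator[OF bij])
  \<comment> \<open>The fixed generator has opposite colours in the two trees.\<close>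
  then show False
    using rels[of 0 "[node 0 []]"] by (simp add: tree_def tree_lang_def)
qed

theorem theorem5p16:
  "\<exists>(L :: (nat, nat) lang) (A :: (nat, nat, nat) struct).
     is_struct L A \<and> finitely_generated L A \<and> \<not> Th2_quasi_categorical L A"
proof (intro exI conjI)
  \<comment> \<open>The two instances of \<open>shift\<close> go in opposite directions between the
    trees.\<close>
  have "\<forall>\<phi> \<in> Th2 tree_lang (tree True). models (tree False) \<phi>"
    using Th2_subset locally_retractable_shift[of True] locally_retractable_shift[of False] by force
  then show "\<not> Th2_quasi_categorical tree_lang (tree True)"
    using not_isomorphic_tree[of True] is_struct_tree finitely_generated_tree
    unfolding Th2_quasi_categorical_def by auto
qed (rule is_struct_tree finitely_generated_tree)+

end
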